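(* Let $q(x,y)\in\mathbb{C}[x,y]$ have no zeros in $\mathbb{H}^2$, bidegree $(m,n)$, finitely many zeros on $\mathbb{R}^2$, and $q(0,0)=0$. Assume $\frac{\partial q}{\partial y}(0)\neq0$ and that $q$ has contact order $K>2$ at $(0,0)$. Set $$p(x,y,z)=(2i+x+y)^m\,q\!\left(\frac{i(x+y)+2xy}{2i+x+y},\,z\right).$$ Then $p(x,y,z)\neq0$ for $(x,y,z)\in\mathbb{H}^3$ and $p$ has finitely many zeros on $\mathbb{R}^3$. Furthermore, there is a parametrization of the zero set $\mathcal{Z}_p=\{(x,y,z):p(x,y,z)=0\}$ near $0$ of the form $z+\phi(x,y)=0$, with $\phi$ analytic near $0$ and $\phi(0)=0$, such that $\operatorname{Im}\phi_2(x,y)\not\equiv0$ and $\operatorname{Im}\phi_k(x,y)=0$ when $x=y$, for all $k<K$.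
   Context: $\mathbb{H}=\{z\in\mathbb{C}:\operatorname{Im}z>0\}$. Bidegree $(m,n)$ means degree $m$ in the first variable and degree $n$ in the second. For such a $q$, the contact order of $q$ at $(0,0)$ is the positive even integer $K$ measuring how the zero set of $q$ approaches $(0,0)$ in the following sense: for real $x$ sufficiently close to $0$, $$\inf\{|\operatorname{Im}y|:q(x,y)=0\}\asymp|x|^K,$$ where $y$ ranges over zeros near $0$, and $f\asymp g$ means $c f\le g\le Cf$ near $0$ for some constants $c,C>0$. $\phi=\sum_{k\ge1}\phi_k$ is the expansion of $\phi$ into homogeneous polynomials $\phi_k$ of degree $k$, and for a power series $f$, $\operatorname{Im}f$ is the power series obtained by taking imaginary parts of the coefficients of $f$. *)

theory Defs
  imports
    "HOL-Analysis.Analysis"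
    "HOL-Library.Landau_Symbols"
    "HOL-Computational_Algebra.Polynomial"
begin

text \<open>
  Polynomials in several variables are nested univariate ones: the innermost variable is the
  first one, so \<open>q :: complex poly poly\<close> is a polynomial in the second variable
  whose coefficients are polynomials in the first.
\<close>

definition poly2 :: "complex poly poly \<Rightarrow> complex \<Rightarrow> complex \<Rightarrow> complex" where
  "poly2 q x y = poly (poly q [:y:]) x"

definition poly3 :: "complex poly poly poly \<Rightarrow> complex \<Rightarrow> complex \<Rightarrow> complex \<Rightarrow> complex" where
  "poly3 p x y z = poly2 (poly p [:[:z:]:]) x y"

definition bidegree :: "complex poly poly \<Rightarrow> nat \<times> nat" where
  "bidegree q = (MAX k\<in>{..degree q}. degree (coeff q k), degree q)"

text \<open>
  The zeros \<open>y\<close> near 0 are those with \<open>norm y < r\<close>, for every sufficiently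
  small radius \<open>r\<close>; how close \<open>x\<close> has to be to 0, and the constants of the
  two-sided estimate, may depend on \<open>r\<close>.  The estimate forces the set of zeros to be nonempty for
  \<open>x\<close> close to 0, since \<open>Inf {}\<close> is a constant.
\<close>

definition has_contact_order :: "complex poly poly \<Rightarrow> nat \<Rightarrow> bool" where
  "has_contact_order q K \<longleftrightarrow> 0 < K \<and> even K \<and>
     (\<forall>\<^sub>F r in at_right (0::real).
        (\<lambda>x::real. Inf {\<bar>Im y\<bar> |y. norm y < r \<and> poly2 q (of_real x) y = 0})
          \<in> \<Theta>[at 0](\<lambda>x. \<bar>x\<bar> ^ K))"

text \<open>
  Analyticity near the origin of a function of two complex variables; \<open>a j k\<close> is the
  coefficient of \<open>x ^ j * y ^ k\<close>.
\<close>

definition has_power_series2_at_0 ::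
  "(complex \<Rightarrow> complex \<Rightarrow> complex) \<Rightarrow> (nat \<Rightarrow> nat \<Rightarrow> complex) \<Rightarrow> bool" where
  "has_power_series2_at_0 f a \<longleftrightarrow>
     (\<exists>r>0. \<forall>x y. norm x < r \<and> norm y < r \<longrightarrow>
        ((\<lambda>(j, k). a j k * x ^ j * y ^ k) has_sum f x y) UNIV)"

definition homogeneous_part ::
  "(nat \<Rightarrow> nat \<Rightarrow> complex) \<Rightarrow> nat \<Rightarrow> complex \<Rightarrow> complex \<Rightarrow> complex" where
  "homogeneous_part a d x y = (\<Sum>j\<le>d. a j (d - j) * x ^ j * y ^ (d - j))"

definition Im_series :: "(nat \<Rightarrow> nat \<Rightarrow> complex) \<Rightarrow> nat \<Rightarrow> nat \<Rightarrow> complex" where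
  "Im_series a j k = of_real (Im (a j k))"

lemma poly2_altdef:
  assumes "bidegree q = (m, n)"
  shows "poly2 q x y = (\<Sum>k\<le>n. \<Sum>j\<le>m. coeff (coeff q k) j * x ^ j * y ^ k)"
proof -
  have n: "n = degree q" and m: "m = (MAX k\<in>{..degree q}. degree (coeff q k))"
    using assms by (auto simp: bidegree_def)
  have deg: "degree (coeff q k) \<le> m" if "k \<le> n" for k
    unfolding m using that n by (intro Max_ge) auto
  have inner: "poly c x = (\<Sum>j\<le>m. coeff c j * x ^ j)" if "degree c \<le> m" for c :: "complex poly"
    unfolding poly_altdef using that
    by (intro sum.mono_neutral_left) (auto simp: coeff_eq_0)
  have "poly2 q x y = (\<Sum>k\<le>n. poly (coeff q k) x * y ^ k)"
    unfolding poly2_def poly_altdef[of q] n by (simp add: poly_sum)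
  also have "\<dots> = (\<Sum>k\<le>n. \<Sum>j\<le>m. coeff (coeff q k) j * x ^ j * y ^ k)"
    by (intro sum.cong refl) (simp add: inner deg sum_distrib_right)
  finally show ?thesis .
qed

text \<open>
  Substituting \<open>(i(x + y) + 2xy) / (2i + x + y)\<close> for the first variable of \<open>q\<close>, which has
  degree \<open>m\<close>, and multiplying by \<open>(2i + x + y) ^ m\<close> gives a polynomial.
\<close>

lemma ex_substituted_poly:
  assumes "bidegree q = (m, n)"
  shows "\<exists>p. \<forall>x y z. 2 * \<i> + x + y \<noteq> 0 \<longrightarrow>
    poly3 p x y z = (2 * \<i> + x + y) ^ m *
      poly2 q ((\<i> * (x + y) + 2 * x * y) / (2 * \<i> + x + y)) z"
proof -
  define X Y Z :: "complex poly poly poly"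
    where "X = [:[:[:0, 1:]:]:]" and "Y = [:[:0, 1:]:]" and "Z = [:0, 1:]"
  define C :: "complex \<Rightarrow> complex poly poly poly" where "C c = [:[:[:c:]:]:]" for c
  define p where "p = (\<Sum>k\<le>n. \<Sum>j\<le>m. C (coeff (coeff q k) j) *
    (C \<i> * (X + Y) + C 2 * X * Y) ^ j * (C (2 * \<i>) + X + Y) ^ (m - j) * Z ^ k)"
  have p: "poly3 p x y z = (\<Sum>k\<le>n. \<Sum>j\<le>m. coeff (coeff q k) j *
    (\<i> * (x + y) + 2 * x * y) ^ j * (2 * \<i> + x + y) ^ (m - j) * z ^ k)" for x y z
    unfolding p_def poly3_def poly2_def
    by (simp add: poly_sum X_def Y_def Z_def C_def algebra_simps)
  show ?thesis
  proof (intro exI[of _ p] allI impI)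
    fix x y z :: complex
    assume nz: "2 * \<i> + x + y \<noteq> 0"
    show "poly3 p x y z = (2 * \<i> + x + y) ^ m *
      poly2 q ((\<i> * (x + y) + 2 * x * y) / (2 * \<i> + x + y)) z"
      unfolding p poly2_altdef[OF assms] sum_distrib_left
    proof (intro sum.cong refl)
      fix k j assume "j \<in> {..m}"
      then have "(2 * \<i> + x + y) ^ m = (2 * \<i> + x + y) ^ (m - j) * (2 * \<i> + x + y) ^ j"
        by (simp flip: power_add)
      then show "coeff (coeff q k) j * (\<i> * (x + y) + 2 * x * y) ^ j *
          (2 * \<i> + x + y) ^ (m - j) * z ^ k = (2 * \<i> + x + y) ^ m *
          (coeff (coeff q k) j * ((\<i> * (x + y) + 2 * x * y) / (2 * \<i> + x + y)) ^ j * z ^ k)"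
        using nz by (simp add: power_divide)
    qed
  qed
qed

end

theory Submission
  imports Defs "HOL-Complex_Analysis.Complex_Analysis"
begin

text \<open>
  The first variable of \<open>q\<close> is replaced by a mean \<open>M(x, y)\<close> of \<open>x\<close> and \<open>y\<close>: the Cayley transform carries
  the upper half plane to the unit disc, and \<open>M\<close> is the arithmetic mean of the disc in half plane
  coordinates (\<open>disc_mean\<close>). Convexity of the disc gives \<open>Im M > 0\<close> for \<open>x\<close> and \<open>y\<close> in the half plane, and so \<open>p\<close>
  inherits stability from \<open>q\<close>. Strict convexity gives more: for real \<open>x\<close> and \<open>y\<close>, \<open>M\<close> is real only if \<open>x = y\<close>,
  and \<open>M(x, x) = x\<close>. By Hurwitz's theorem \<open>q\<close> has no zero whose first coordinate is in the open half plane and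
  whose second coordinate is real (\<open>poly2_nonzero_half_plane_real\<close>). Hence all real zeros of \<open>p\<close> are of the form
  \<open>(x, x, z)\<close> with \<open>q(x, z) = 0\<close>, and there are only finitely many.

  Near the origin the zeros of \<open>q\<close> form a branch \<open>y + \<psi>(x) = 0\<close> with \<open>\<psi> = b\<^sub>1 x + b\<^sub>2 x\<^sup>2 + \<dots>\<close> holomorphic
  (\<open>holomorphic_implicit_function\<close>), so the zeros of \<open>p\<close> are given by \<open>\<phi>(x, y) = \<psi>(M(x, y))\<close>. The contact order
  says that \<open>Im \<psi>\<close> is of size \<open>\<bar>x\<bar> ^ K\<close> on the real line; thus \<open>b\<^sub>k\<close> is real for \<open>k < K\<close>. As \<open>\<phi>(x, x) = \<psi>(x)\<close>, these are
  the values of the homogeneous parts of \<open>\<phi>\<close> at \<open>(1, 1)\<close>, whose imaginary parts therefore vanish.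

  In degree 2, \<open>M = (x + y) / 2 + \<i> (x - y)\<^sup>2 / 4 + \<dots>\<close> and \<open>b\<^sub>1\<close>, \<open>b\<^sub>2\<close> are real because \<open>K > 2\<close>, so the imaginary
  part of \<open>\<phi>\<^sub>2\<close> is \<open>b\<^sub>1 (x - y)\<^sup>2 / 4\<close>. It remains to see that \<open>b\<^sub>1 \<noteq> 0\<close>. Stability of \<open>q\<close> makes \<open>\<psi>\<close> map points of the
  upper half plane near 0 into the closed upper half plane, whereas a function with a zero of order at
  least 2 would wrap a half disc all around 0 (\<open>linear_coeff_nonzero_if_upper_half_plane\<close>).

  The definition of analyticity asks for an unconditionally convergent double series. It is obtained by
  iterating one-variable expansions with Cauchy estimates (\<open>has_power_series2_at_0_if_holomorphic\<close>). Its
  coefficients are then only compared on the lines \<open>y = 0\<close> and \<open>x = y\<close>, where they reduce to power series in one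
  variable.
\<close>


section \<open>Leading terms of power series\<close>

lemma powser_coeff_0:
  fixes b :: "nat \<Rightarrow> 'a::real_normed_field"
  assumes "r > 0" and sums: "\<And>x. norm x < r \<Longrightarrow> (\<lambda>n. b n * x ^ n) sums f x"
  shows "b 0 = f 0"
  using sums_unique2[OF powser_sums_zero[of b] sums[of 0]] \<open>r > 0\<close> by simp

lemma powser_remainder_tendsto:
  fixes b :: "nat \<Rightarrow> 'a::{real_normed_field,banach}"
  assumes "r > 0" and sums: "\<And>x. norm x < r \<Longrightarrow> (\<lambda>n. b n * x ^ n) sums f x"
  shows "((\<lambda>x. (f x - (\<Sum>i<j. b i * x ^ i)) / x ^ j) \<longlongrightarrow> b j) (at 0)"
proof -
  have "((\<lambda>x. (f x - (\<Sum>i<j. b i * x ^ i)) / x ^ j) \<longlongrightarrow> b (0 + j)) (at 0)"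
  proof (rule powser_limit_0_strong[OF \<open>r > 0\<close>])
    fix x :: 'a assume x: "x \<noteq> 0" "norm x < r"
    have "(\<lambda>n. b (n + j) * x ^ (n + j) / x ^ j) sums ((f x - (\<Sum>i<j. b i * x ^ i)) / x ^ j)"
      by (intro sums_divide sums_split_initial_segment sums x)
    thus "(\<lambda>n. b (n + j) * x ^ n) sums ((f x - (\<Sum>i<j. b i * x ^ i)) / x ^ j)"
      using x by (simp add: power_add)
  qed
  thus ?thesis by simp
qed

lemma powser_leading_coeff:
  fixes b :: "nat \<Rightarrow> 'a::{real_normed_field,banach}"
  assumes "r > 0" and sums: "\<And>x. norm x < r \<Longrightarrow> (\<lambda>n. b n * x ^ n) sums f x"
    and zero: "\<And>i. i < j \<Longrightarrow> b i = 0"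
  shows "((\<lambda>x. f x / x ^ j) \<longlongrightarrow> b j) (at 0)"
  using powser_remainder_tendsto[OF \<open>r > 0\<close> sums, of j] zero by simp

text \<open>
  The first nonvanishing coefficient determines the order of decay at 0, so it cannot come before index \<open>K\<close>.
\<close>

lemma powser_coeff_eq_0_if_bigo:
  fixes b :: "nat \<Rightarrow> real"
  assumes "r > 0" and sums: "\<And>x. norm x < r \<Longrightarrow> (\<lambda>n. b n * x ^ n) sums f x"
    and bigo: "f \<in> O[at 0](\<lambda>x. \<bar>x\<bar> ^ K)" and "k < K"
  shows "b k = 0"
  using \<open>k < K\<close>
proof (induction k rule: less_induct)
  case (less k)
  have lim: "((\<lambda>x. f x / x ^ k) \<longlongrightarrow> b k) (at 0)"
    using less by (intro powser_leading_coeff[OF \<open>r > 0\<close> sums]) auto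
  obtain C where "eventually (\<lambda>x. norm (f x) \<le> C * norm (\<bar>x\<bar> ^ K)) (at 0)"
    using bigo by (auto elim: landau_o.bigE)
  moreover have "eventually (\<lambda>x::real. x \<noteq> 0) (at 0)"
    by (rule eventually_neq_at_within)
  ultimately have "eventually (\<lambda>x. norm (f x / x ^ k) \<le> C * \<bar>x\<bar> ^ (K - k)) (at 0)"
  proof eventually_elim
    case (elim x)
    have "\<bar>x\<bar> ^ K = \<bar>x\<bar> ^ (K - k) * \<bar>x\<bar> ^ k"
      using less.prems by (simp flip: power_add)
    thus ?case
      using elim by (simp add: power_abs field_simps)
  qed
  moreover have "((\<lambda>x. C * \<bar>x\<bar> ^ (K - k)) \<longlongrightarrow> C * \<bar>0::real\<bar> ^ (K - k)) (at 0)"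
    by (intro tendsto_intros)
  hence "((\<lambda>x::real. C * \<bar>x\<bar> ^ (K - k)) \<longlongrightarrow> 0) (at 0)"
    using less.prems by (simp add: zero_power)
  ultimately have "((\<lambda>x. f x / x ^ k) \<longlongrightarrow> 0) (at 0)"
    by (rule Lim_null_comparison)
  with lim show ?case
    using LIM_unique by blast
qed

text \<open>
  As \<open>u\<close> runs through the upper half of the unit circle, the argument of \<open>u ^ j\<close> with \<open>j \<ge> 2\<close> runs
  through an open interval of length at least \<open>2 * pi\<close>, so \<open>b * u ^ j\<close> meets the lower half plane.
\<close>

lemma exists_upper_direction_power_lower:
  fixes b :: complex
  assumes "b \<noteq> 0" "2 \<le> j"
  shows "\<exists>u. Im u > 0 \<and> Im (b * u ^ j) < 0"
proof -
  \<comment> \<open>The argument of the product is to be a \<open>\<beta>\<close> with negative sine, reached from \<open>Arg b\<close> by a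
  positive rotation of less than \<open>2 * pi\<close>. No single \<open>\<beta>\<close> does this for all \<open>b\<close>, since the rotation
  degenerates when \<open>b\<close> already points in the direction \<open>\<beta>\<close>.\<close>
  define \<beta> where "\<beta> = (if Arg b < - (pi / 4) then - (pi / 4) else 3 / 2 * pi)"
  define \<theta> where "\<theta> = (\<beta> - Arg b) / j"
  have Arg: "- pi < Arg b" "Arg b \<le> pi"
    using Arg_bounded by auto
  have "0 < \<beta> - Arg b" "\<beta> - Arg b < 2 * pi"
    using Arg pi_gt_zero by (auto simp: \<beta>_def)
  moreover have "2 * pi \<le> j * pi"
    using assms(2) by (intro mult_right_mono) auto
  ultimately have "0 < \<beta> - Arg b" "\<beta> - Arg b < pi * j"
    by (linarith, metis mult.commute order_less_le_trans)
  hence \<theta>: "0 < \<theta>" "\<theta> < pi"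
    using assms(2) unfolding \<theta>_def by (simp_all add: pos_divide_less_eq)
  have "b * cis \<theta> ^ j = of_real (cmod b) * (cis (Arg b) * cis (real j * \<theta>))"
    by (metis Complex.DeMoivre mult.assoc rcis_cmod_Arg rcis_def)
  also have "cis (Arg b) * cis (real j * \<theta>) = cis \<beta>"
    using assms(2) by (simp add: cis_mult \<theta>_def)
  finally have "Im (b * cis \<theta> ^ j) = cmod b * sin \<beta>"
    by simp
  moreover have "sin \<beta> < 0"
    using sin_gt_zero[of "pi / 4"] pi_gt_zero sin_3over2_pi unfolding \<beta>_def
    by (auto simp del: times_divide_eq_left)
  ultimately have "Im (b * cis \<theta> ^ j) < 0"
    using assms(1) by (simp add: mult_pos_neg)
  moreover have "Im (cis \<theta>) > 0"
    using \<theta> by (simp add: sin_gt_zero)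
  ultimately show ?thesis by blast
qed

text \<open>
  If \<open>f\<close> started with a term of degree \<open>j \<ge> 2\<close>, it would wrap the half disc at least once around 0
  and reach the lower half plane. This is an instance of Hopf's boundary
  lemma for the harmonic function \<open>Im f\<close>.
\<close>

lemma linear_coeff_nonzero_if_upper_half_plane:
  fixes b :: "nat \<Rightarrow> complex"
  assumes "r > 0" and sums: "\<And>x. norm x < r \<Longrightarrow> (\<lambda>n. b n * x ^ n) sums f x"
    and upper: "\<And>x. norm x < r \<Longrightarrow> Im x > 0 \<Longrightarrow> Im (f x) \<ge> 0"
    and "b 0 = 0" and nonzero: "norm x0 < r" "f x0 \<noteq> 0"
  shows "b 1 \<noteq> 0"
proof
  assume "b 1 = 0"
  have "\<exists>j. b j \<noteq> 0"
  proof (rule ccontr)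
    assume "\<not> ?thesis"
    hence "(\<lambda>n. b n * x0 ^ n) sums 0" by simp
    with sums[OF nonzero(1)] nonzero(2) sums_unique2 show False by blast
  qed
  define j where "j = (LEAST j. b j \<noteq> 0)"
  have bj: "b j \<noteq> 0"
    unfolding j_def using \<open>\<exists>j. b j \<noteq> 0\<close> by (rule LeastI_ex)
  have less: "b i = 0" if "i < j" for i
    using not_less_Least that unfolding j_def by blast
  have "2 \<le> j"
    using bj \<open>b 0 = 0\<close> \<open>b 1 = 0\<close> by (metis One_nat_def Suc_leI less_2_cases not_less)
  then obtain u where u: "Im u > 0" "Im (b j * u ^ j) < 0"
    using exists_upper_direction_power_lower[OF bj] by blast
  have u_nz: "u \<noteq> 0" using u by auto
  \<comment> \<open>Along the ray through \<open>u\<close>, the function is \<open>\<epsilon> ^ j * b j * u ^ j\<close> to leading order.\<close>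
  have "((\<lambda>x. f x / x ^ j) \<longlongrightarrow> b j) (at 0)"
    by (rule powser_leading_coeff[OF \<open>r > 0\<close> sums less])
  moreover have "filterlim (\<lambda>\<epsilon>. complex_of_real \<epsilon> * u) (at 0) (at_right 0)"
    unfolding filterlim_at using u_nz
    by (auto intro!: tendsto_eq_intros simp: eventually_at_filter)
  ultimately have "((\<lambda>\<epsilon>. f (complex_of_real \<epsilon> * u) / (complex_of_real \<epsilon> * u) ^ j) \<longlongrightarrow> b j) (at_right 0)"
    by (rule filterlim_compose)
  hence "((\<lambda>\<epsilon>. Im (f (complex_of_real \<epsilon> * u) / (complex_of_real \<epsilon> * u) ^ j * u ^ j)) \<longlongrightarrow>
           Im (b j * u ^ j)) (at_right 0)"
    by (intro tendsto_intros)
  moreover have "eventually (\<lambda>\<epsilon>. 0 \<le> Im (f (complex_of_real \<epsilon> * u) / (complex_of_real \<epsilon> * u) ^ j * u ^ j))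
                   (at_right 0)"
  proof -
    have "eventually (\<lambda>\<epsilon>::real. \<epsilon> < r / norm u) (at_right 0)"
      using \<open>r > 0\<close> u_nz by (intro eventually_at_rightI[of 0 "r / norm u"]) auto
    moreover have "eventually (\<lambda>\<epsilon>::real. \<epsilon> > 0) (at_right 0)"
      by (rule eventually_at_right_less)
    ultimately show ?thesis
    proof eventually_elim
      case (elim \<epsilon>)
      have "0 \<le> Im (f (complex_of_real \<epsilon> * u))"
        using elim u u_nz by (intro upper) (auto simp: norm_mult field_simps)
      moreover have "f (complex_of_real \<epsilon> * u) / (complex_of_real \<epsilon> * u) ^ j * u ^ j =
          f (complex_of_real \<epsilon> * u) / complex_of_real (\<epsilon> ^ j)"
        using u_nz elim by (simp add: power_mult_distrib field_simps)
      ultimately show ?case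
        using elim by (simp add: Im_divide_of_real)
    qed
  qed
  ultimately have "0 \<le> Im (b j * u ^ j)"
    by (rule tendsto_lowerbound) auto
  with u show False by simp
qed


section \<open>Double power series of holomorphic functions\<close>

text \<open>
  Differentiation under the integral sign in Cauchy's formula shows that the Taylor coefficients in one
  variable depend holomorphically on the other one.
\<close>

lemma holomorphic_on_higher_deriv_param:
  fixes F F' :: "complex \<Rightarrow> complex \<Rightarrow> complex"
  assumes "R > 0"
    and hol: "\<And>y. y \<in> ball 0 R \<Longrightarrow> (\<lambda>x. F x y) holomorphic_on ball 0 R"
    and der: "\<And>x y. x \<in> ball 0 R \<Longrightarrow> y \<in> ball 0 R \<Longrightarrow>
                ((\<lambda>y. F x y) has_field_derivative F' x y) (at y)"
    and cont: "continuous_on (ball 0 R \<times> ball 0 R) (\<lambda>(x, y). F' x y)"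
  shows "(\<lambda>y. (deriv ^^ j) (\<lambda>x. F x y) 0) holomorphic_on ball 0 R"
proof -
  define \<rho> where "\<rho> = R / 2"
  have \<rho>: "\<rho> > 0" "\<rho> < R"
    using \<open>R > 0\<close> by (auto simp: \<rho>_def)
  define \<gamma> where "\<gamma> = (\<lambda>t::real. complex_of_real \<rho> * exp (2 * complex_of_real pi * \<i> * t))"
  \<comment> \<open>On the circle, \<open>d\<gamma> = 2 * pi * \<i> * \<gamma> dt\<close> cancels one of the \<open>j + 1\<close> powers in Cauchy's formula.\<close>
  define w where "w = (\<lambda>t. 2 * pi * \<i> / \<gamma> t ^ j)"
  have \<gamma>_ball: "\<gamma> t \<in> ball 0 R" and \<gamma>_nz: "\<gamma> t \<noteq> 0" for t
    using \<rho> by (auto simp: \<gamma>_def norm_mult)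
  have cont_\<gamma>: "continuous_on S \<gamma>" for S
    unfolding \<gamma>_def by (intro continuous_intros)
  have cont_w: "continuous_on S w" for S
    unfolding w_def by (intro continuous_intros cont_\<gamma>) (auto simp: \<gamma>_nz)
  have Cauchy: "(deriv ^^ j) (\<lambda>x. F x y) 0 =
      fact j / (2 * pi * \<i>) * integral (cbox 0 1) (\<lambda>t. F (\<gamma> t) y * w t)"
    if y: "y \<in> ball 0 R" for y
  proof -
    have sub: "cball 0 \<rho> \<subseteq> ball (0::complex) R"
      using \<rho> by auto
    have "contour_integral (circlepath 0 \<rho>) (\<lambda>u. F u y / (u - 0) ^ Suc j) =
            (2 * pi * \<i>) * (deriv ^^ j) (\<lambda>x. F x y) 0 / fact j"
    proof (rule Cauchy_contour_integral_circlepath)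
      show "continuous_on (cball 0 \<rho>) (\<lambda>u. F u y)"
        using hol[OF y] sub continuous_on_subset holomorphic_on_imp_continuous_on by blast
      show "(\<lambda>u. F u y) holomorphic_on ball 0 \<rho>"
        using hol[OF y] by (rule holomorphic_on_subset) (use \<rho> in auto)
    qed (use \<rho> in auto)
    moreover have "F u y / (u - 0) ^ Suc j * (2 * pi * \<i> * u) =
        F u y * (2 * pi * \<i> / u ^ j)" if "u \<noteq> 0" for u
      using that by (simp add: field_simps)
    hence "contour_integral (circlepath 0 \<rho>) (\<lambda>u. F u y / (u - 0) ^ Suc j) =
        integral (cbox 0 1) (\<lambda>t. F (\<gamma> t) y * w t)"
      unfolding contour_integral_integral vector_derivative_circlepath interval_cbox w_def
      using \<gamma>_nz by (intro integral_cong) (simp add: circlepath_def part_circlepath_def 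
           linepath_def \<gamma>_def mult_ac)
    ultimately show ?thesis
      by (simp add: field_simps)
  qed
  have "(\<lambda>y. integral (cbox 0 1) (\<lambda>t. F (\<gamma> t) y * w t)) holomorphic_on ball 0 R"
  proof (rule leibniz_rule_holomorphic)
    fix y :: complex and t :: real
    assume y: "y \<in> ball 0 R"
    show "((\<lambda>y. F (\<gamma> t) y * w t) has_field_derivative F' (\<gamma> t) y * w t) (at y within ball 0 R)"
      by (intro DERIV_cmult_right DERIV_subset[OF der[OF \<gamma>_ball y]]) auto
  next
    fix y :: complex
    assume y: "y \<in> ball 0 R"
    have "continuous_on (cbox 0 1) (\<lambda>t. F (\<gamma> t) y)"
      by (rule continuous_on_compose2[OF holomorphic_on_imp_continuous_on[OF hol[OF y]] cont_\<gamma>])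
         (use \<gamma>_ball in auto)
    thus "(\<lambda>t. F (\<gamma> t) y * w t) integrable_on cbox 0 1"
      by (intro integrable_continuous continuous_intros cont_w)
  next
    have "continuous_on (ball 0 R \<times> cbox 0 1) (\<lambda>z. case (\<gamma> (snd z), fst z) of (x, y) \<Rightarrow> F' x y)"
      by (rule continuous_on_compose2[OF cont])
         (use \<gamma>_ball in \<open>auto intro!: continuous_intros continuous_on_compose2[OF cont_\<gamma>[of UNIV]]\<close>)
    moreover have "continuous_on (ball 0 R \<times> cbox 0 1) (\<lambda>z::complex \<times> real. w (snd z))"
      by (intro continuous_on_compose2[OF cont_w[of UNIV]] continuous_intros) auto
    ultimately show "continuous_on (ball 0 R \<times> cbox 0 1) (\<lambda>(y, t). F' (\<gamma> t) y * w t)"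
      by (auto simp: case_prod_unfold intro!: continuous_intros)
  qed auto
  hence "(\<lambda>y. fact j / (2 * pi * \<i>) * integral (cbox 0 1) (\<lambda>t. F (\<gamma> t) y * w t))
           holomorphic_on ball 0 R"
    by (intro holomorphic_intros)
  thus ?thesis
    by (rule holomorphic_transform) (simp add: Cauchy)
qed

text \<open>
  Expanding in \<open>x\<close> and then expanding every coefficient in \<open>y\<close> gives an iterated series. Applying the
  Cauchy inequality twice bounds \<open>a j k\<close> by \<open>B / \<rho> ^ (j + k)\<close>, so the double series is dominated by a
  product of geometric series and can be summed in any order.
\<close>

lemma has_power_series2_at_0_if_holomorphic:
  fixes F F' :: "complex \<Rightarrow> complex \<Rightarrow> complex"
  assumes "R > 0"
    and hol: "\<And>y. y \<in> ball 0 R \<Longrightarrow> (\<lambda>x. F x y) holomorphic_on ball 0 R"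
    and der: "\<And>x y. x \<in> ball 0 R \<Longrightarrow> y \<in> ball 0 R \<Longrightarrow>
                ((\<lambda>y. F x y) has_field_derivative F' x y) (at y)"
    and cont_F: "continuous_on (ball 0 R \<times> ball 0 R) (\<lambda>(x, y). F x y)"
    and cont_F': "continuous_on (ball 0 R \<times> ball 0 R) (\<lambda>(x, y). F' x y)"
  shows "\<exists>a. has_power_series2_at_0 F a"
proof -
  define \<rho> where "\<rho> = R / 2"
  have \<rho>: "\<rho> > 0" "\<rho> < R"
    using \<open>R > 0\<close> by (auto simp: \<rho>_def)
  define c where "c = (\<lambda>j y. (deriv ^^ j) (\<lambda>x. F x y) 0 / fact j)"
  define a where "a = (\<lambda>j k. (deriv ^^ k) (c j) 0 / fact k)"
  have hol_c: "c j holomorphic_on ball 0 R" for j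
    unfolding c_def
    by (intro holomorphic_intros holomorphic_on_higher_deriv_param[OF \<open>R > 0\<close> hol der cont_F']) auto
  have "compact ((\<lambda>(x, y). F x y) ` (cball 0 \<rho> \<times> cball 0 \<rho>))"
    by (intro compact_continuous_image continuous_on_subset[OF cont_F] compact_Times compact_cball)
       (use \<rho> in auto)
  then obtain B where B: "\<And>x y. x \<in> cball 0 \<rho> \<Longrightarrow> y \<in> cball 0 \<rho> \<Longrightarrow> norm (F x y) \<le> B"
    by (fastforce dest!: compact_imp_bounded simp: bounded_iff)
  have cont_cball: "continuous_on (cball 0 \<rho>) f" "f holomorphic_on ball 0 \<rho>"
    if "f holomorphic_on ball 0 R" for f :: "complex \<Rightarrow> complex"
    using that holomorphic_on_imp_continuous_on[OF that] \<rho>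
    by (auto intro: continuous_on_subset holomorphic_on_subset)
  have bound_c: "norm (c j y) \<le> B / \<rho> ^ j" if y: "y \<in> cball 0 \<rho>" for j y
  proof -
    have yR: "y \<in> ball 0 R" using y \<rho> by auto
    have "norm ((deriv ^^ j) (\<lambda>x. F x y) 0) \<le> fact j * B / \<rho> ^ j"
      using cont_cball[OF hol[OF yR]] \<rho>(1) B y by (intro Cauchy_inequality) auto
    thus ?thesis
      by (simp add: c_def norm_divide field_simps)
  qed
  have bound_a: "norm (a j k) \<le> B / \<rho> ^ j / \<rho> ^ k" for j k
  proof -
    have "norm ((deriv ^^ k) (c j) 0) \<le> fact k * (B / \<rho> ^ j) / \<rho> ^ k"
      using cont_cball[OF hol_c] \<rho>(1) bound_c by (intro Cauchy_inequality) auto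
    thus ?thesis
      by (simp add: a_def norm_divide field_simps)
  qed
  have "((\<lambda>(j, k). a j k * x ^ j * y ^ k) has_sum F x y) UNIV"
    if "norm x < \<rho>" "norm y < \<rho>" for x y
  proof -
    have xy: "x \<in> ball 0 R" "y \<in> ball 0 R" using that \<rho> by auto
    have geo: "((\<lambda>k. q ^ k) has_sum 1 / (1 - q)) UNIV" if "0 \<le> q" "q < 1" for q :: real
      using that geometric_sums[of q] by (intro norm_summable_imp_has_sum) (auto simp: power_abs)
    define s t where "s = norm x / \<rho>" and "t = norm y / \<rho>"
    have st: "0 \<le> s" "s < 1" "0 \<le> t" "t < 1"
      using that \<rho> by (auto simp: s_def t_def)
    have bound: "norm (a j k * x ^ j * y ^ k) \<le> B * (s ^ j * t ^ k)" for j k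
    proof -
      have "norm (a j k * x ^ j * y ^ k) \<le> (B / \<rho> ^ j / \<rho> ^ k) * norm x ^ j * norm y ^ k"
        unfolding norm_mult norm_power by (intro mult_right_mono bound_a) auto
      thus ?thesis by (simp add: s_def t_def power_divide mult_ac)
    qed
    have "(\<lambda>(j, k). s ^ j * t ^ k) summable_on (UNIV \<times> UNIV)"
      by (rule summable_on_SigmaI[where g = "\<lambda>j. s ^ j * (1 / (1 - t))"])
         (use st in \<open>auto simp del: times_divide_eq_right intro!: has_sum_cmult_right geo summable_on_cmult_left
             has_sum_imp_summable[OF geo]\<close>)
    hence "(\<lambda>jk. B * (case jk of (j, k) \<Rightarrow> s ^ j * t ^ k)) summable_on (UNIV \<times> UNIV)"
      by (rule summable_on_cmult_right)
    hence "(\<lambda>jk. norm (case jk of (j, k) \<Rightarrow> a j k * x ^ j * y ^ k)) summable_on (UNIV \<times> UNIV)"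
      by (rule Infinite_Sum.abs_summable_on_comparison_test') (use bound in auto)
    hence summable: "(\<lambda>(j, k). a j k * x ^ j * y ^ k) summable_on (UNIV \<times> UNIV)"
      by (rule Infinite_Sum.abs_summable_summable)
    have summable_st: "summable (\<lambda>k. A * q ^ k)" if "0 \<le> q" "q < 1" for A q :: real
      using that by (intro summable_mult summable_geometric) auto
    have inner: "((\<lambda>k. a j k * x ^ j * y ^ k) has_sum c j y * x ^ j) UNIV" for j
    proof (rule norm_summable_imp_has_sum)
      show "summable (\<lambda>k. norm (a j k * x ^ j * y ^ k))"
        by (rule summable_comparison_test'[OF summable_st[OF st(3,4), of "B * s ^ j"], of 0])
           (use bound in \<open>auto simp: mult_ac\<close>)
      show "(\<lambda>k. a j k * x ^ j * y ^ k) sums (c j y * x ^ j)"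
        using sums_mult2[OF holomorphic_power_series[OF hol_c[of j] xy(2)], where c = "x ^ j"]
        by (simp add: a_def mult_ac)
    qed
    have outer: "((\<lambda>j. c j y * x ^ j) has_sum F x y) UNIV"
    proof (rule norm_summable_imp_has_sum)
      have "norm (c j y * x ^ j) \<le> B * s ^ j" for j
      proof -
        have "norm (c j y * x ^ j) \<le> (B / \<rho> ^ j) * norm x ^ j"
          unfolding norm_mult norm_power using that by (intro mult_right_mono bound_c) auto
        thus ?thesis by (simp add: s_def power_divide)
      qed
      thus "summable (\<lambda>j. norm (c j y * x ^ j))"
        by (intro summable_comparison_test'[OF summable_st[OF st(1,2), of B], of 0]) auto
      show "(\<lambda>j. c j y * x ^ j) sums F x y"
        using holomorphic_power_series[OF hol[OF xy(2)] xy(1)] by (simp add: c_def)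
    qed
    show ?thesis
      using has_sum_SigmaI[OF _ outer summable] inner by simp
  qed
  thus ?thesis
    unfolding has_power_series2_at_0_def using \<rho>(1) by blast
qed

text \<open>
  Restricting to a complex line through the origin collects the double series along antidiagonals. This
  reduces questions on homogeneous parts to power series in one variable.
\<close>

lemma homogeneous_part_sums:
  assumes "has_power_series2_at_0 f a"
  shows "\<exists>r>0. \<forall>t. norm t < r \<longrightarrow> (\<lambda>d. homogeneous_part a d x y * t ^ d) sums f (t * x) (t * y)"
proof -
  obtain r where r: "r > 0" and f: "\<And>x y. norm x < r \<Longrightarrow> norm y < r \<Longrightarrow>
      ((\<lambda>(j, k). a j k * x ^ j * y ^ k) has_sum f x y) UNIV"
    using assms unfolding has_power_series2_at_0_def by blast
  define C where "C = 1 + norm x + norm y"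
  have "C > 0" unfolding C_def by (smt (verit) norm_ge_zero)
  show ?thesis
  proof (intro exI[of _ "r / C"] conjI allI impI)
    fix t :: complex
    assume t: "norm t < r / C"
    have "norm t * C < r"
      using t \<open>C > 0\<close> by (simp add: field_simps)
    moreover have "norm t * norm x \<le> norm t * C" "norm t * norm y \<le> norm t * C"
      unfolding C_def by (intro mult_left_mono; simp)+
    ultimately have "((\<lambda>(j, k). a j k * (t * x) ^ j * (t * y) ^ k) has_sum f (t * x) (t * y)) UNIV"
      by (intro f) (auto simp: norm_mult)
    moreover have "bij_betw (\<lambda>(d, j). (j, d - j)) (SIGMA d:UNIV. {..d::nat}) (UNIV :: (nat \<times> nat) set)"
      by (rule bij_betwI[where g = "\<lambda>(j, k). (j + k, j)"]) auto
    ultimately have "((\<lambda>z. case (case z of (d, j) \<Rightarrow> (j, d - j)) of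
        (j, k) \<Rightarrow> a j k * (t * x) ^ j * (t * y) ^ k) has_sum f (t * x) (t * y)) (SIGMA d:UNIV. {..d})"
      using has_sum_reindex_bij_betw by blast
    hence "((\<lambda>d. homogeneous_part a d x y * t ^ d) has_sum f (t * x) (t * y)) UNIV"
    proof (rule has_sum_SigmaD)
      fix d :: nat
      have "(\<Sum>j\<le>d. a j (d - j) * (t * x) ^ j * (t * y) ^ (d - j)) = homogeneous_part a d x y * t ^ d"
        unfolding homogeneous_part_def sum_distrib_right
      proof (intro sum.cong refl)
        fix j assume "j \<in> {..d}"
        hence "t ^ d = t ^ j * t ^ (d - j)" by (simp flip: power_add)
        thus "a j (d - j) * (t * x) ^ j * (t * y) ^ (d - j) = a j (d - j) * x ^ j * y ^ (d - j) * t ^ d"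
          by (simp add: power_mult_distrib mult_ac)
      qed
      thus "((\<lambda>j. case case (d, j) of (d, j) \<Rightarrow> (j, d - j) of
          (j, k) \<Rightarrow> a j k * (t * x) ^ j * (t * y) ^ k) has_sum homogeneous_part a d x y * t ^ d) {..d}"
        by (metis (no_types, lifting) finite_atMost has_sum_cong has_sum_finite prod.simps(2))
    qed
    thus "(\<lambda>d. homogeneous_part a d x y * t ^ d) sums f (t * x) (t * y)"
      by (rule has_sum_imp_sums)
  qed (use r \<open>C > 0\<close> in auto)
qed

lemma homogeneous_part_Im_series_real:
  "homogeneous_part (Im_series a) d (of_real x) (of_real y) =
     of_real (Im (homogeneous_part a d (of_real x) (of_real y)))"
proof -
  have "Im (z * complex_of_real x ^ j * complex_of_real y ^ k) = Im z * x ^ j * y ^ k" for z j k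
    by (simp add: mult.assoc flip: of_real_power of_real_mult)
  thus ?thesis
    by (simp add: homogeneous_part_def Im_series_def Im_sum)
qed

lemma homogeneous_part_same:
  "homogeneous_part a d x x = homogeneous_part a d 1 1 * x ^ d"
proof -
  have "a j (d - j) * x ^ j * x ^ (d - j) = a j (d - j) * 1 ^ j * 1 ^ (d - j) * x ^ d"
    if "j \<le> d" for j
    using that by (simp add: mult.assoc flip: power_add)
  thus ?thesis
    unfolding homogeneous_part_def sum_distrib_right by (intro sum.cong) auto
qed


section \<open>The holomorphic implicit function theorem\<close>

text \<open>
  The equation is solved by the contraction \<open>y \<mapsto> y - f x y / f' 0 0\<close> of a fixed disc, for all
  small \<open>x\<close> at once. The first hypothesis expresses holomorphy of \<open>f\<close> in both variables in
  the form that makes the iterates holomorphic functions of \<open>x\<close>.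
\<close>

lemma holomorphic_implicit_function:
  fixes f f' :: "complex \<Rightarrow> complex \<Rightarrow> complex"
  assumes hol: "\<And>h S. h holomorphic_on S \<Longrightarrow> (\<lambda>x. f x (h x)) holomorphic_on S"
    and der: "\<And>x y. (f x has_field_derivative f' x y) (at y)"
    and cont: "isCont (\<lambda>(x, y). f' x y) (0, 0)"
    and "f 0 0 = 0" "f' 0 0 \<noteq> 0"
  obtains g \<delta> \<rho> where "\<delta> > 0" "\<rho> > 0" "g holomorphic_on ball 0 \<delta>"
    "\<And>x. norm x < \<delta> \<Longrightarrow> norm (g x) < \<rho>"
    "\<And>x y. norm x < \<delta> \<Longrightarrow> norm y < \<rho> \<Longrightarrow> f x y = 0 \<longleftrightarrow> y = g x"
proof -
  define c where "c = f' 0 0"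
  have c: "c \<noteq> 0" using assms by (simp add: c_def)
  obtain e where e: "e > 0" "\<And>z. dist z (0, 0) < e \<Longrightarrow> dist (case z of (x, y) \<Rightarrow> f' x y) c < norm c / 2"
    using cont c unfolding continuous_at_eps_delta c_def
    by (metis (no_types, lifting) case_prod_conv half_gt_zero zero_less_norm_iff)
  define \<rho> where "\<rho> = e / 2"
  have \<rho>: "\<rho> > 0" using e by (simp add: \<rho>_def)
  \<comment> \<open>\<open>G x\<close> is the Newton step with the derivative frozen at the origin; its fixed points are the
  zeros of \<open>f x\<close>.\<close>
  define G where "G = (\<lambda>x y. y - f x y / c)"
  have "isCont (\<lambda>x. f x 0) 0"
    using hol[of "\<lambda>_. 0" UNIV] holomorphic_on_imp_continuous_on[of "\<lambda>x. f x 0" UNIV]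
    by (auto simp: continuous_on_eq_continuous_at)
  then obtain d where d: "d > 0" "\<And>x. norm x < d \<Longrightarrow> norm (f x 0) < norm c * (\<rho> / 2)"
    using c \<rho> assms(4) unfolding continuous_at_eps_delta
    by (metis dist_0_norm dist_commute half_gt_zero mult_pos_pos zero_less_norm_iff)
  define \<delta> where "\<delta> = min d (e / 2)"
  have \<delta>: "\<delta> > 0" "\<delta> \<le> d" "\<delta> \<le> e / 2" using d e by (auto simp: \<delta>_def)
  have contr: "norm (G x y - G x y') \<le> 1 / 2 * norm (y - y')"
    if "norm x < \<delta>" "norm y \<le> \<rho>" "norm y' \<le> \<rho>" for x y y'
  proof (rule field_differentiable_bound[of "cball 0 \<rho>" "G x" "\<lambda>y. 1 - f' x y / c"])
    fix y :: complex assume y: "y \<in> cball 0 \<rho>"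
    show "(G x has_field_derivative 1 - f' x y / c) (at y within cball 0 \<rho>)"
      unfolding G_def using c DERIV_subset[OF der[of x y]] by (auto intro!: derivative_eq_intros)
    have "norm (x, y) < e"
      using norm_Pair_le[of x y] that(1) y \<delta> by (simp add: \<rho>_def)
    hence "norm (f' x y - c) < norm c / 2"
      using e(2)[of "(x, y)"] by (simp add: dist_norm)
    moreover have "1 - f' x y / c = - (f' x y - c) / c"
      using c by (simp add: field_simps)
    ultimately show "norm (1 - f' x y / c) \<le> 1 / 2"
      using c by (simp add: norm_divide norm_minus_commute field_simps)
  qed (use that in auto)
  have self_map: "norm (G x y) < \<rho>" if "norm x < \<delta>" "norm y \<le> \<rho>" for x y
  proof -
    have "norm (G x 0) < \<rho> / 2"
      using d(2)[of x] that \<delta> c by (simp add: G_def norm_divide field_simps)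
    moreover have "norm (G x y - G x 0) \<le> \<rho> / 2"
      using contr[of x y 0] that \<rho> by simp
    ultimately show ?thesis
      using norm_triangle_sub[of "G x y" "G x 0"] by simp
  qed
  have "\<exists>!y. y \<in> cball 0 \<rho> \<and> G x y = y" if "norm x < \<delta>" for x
  proof -
    have "\<exists>!y\<in>cball 0 \<rho>. G x y = y"
    proof (rule Banach_fix)
      show "complete (cball (0::complex) \<rho>)"
        by (intro compact_imp_complete compact_cball)
      show "dist (G x y) (G x y') \<le> 1 / 2 * dist y y'"
        if "y \<in> cball 0 \<rho>" "y' \<in> cball 0 \<rho>" for y y'
        using contr[OF \<open>norm x < \<delta>\<close>] that by (simp add: dist_norm)
    qed (use \<rho> less_imp_le[OF self_map] that in auto)
    thus ?thesis by blast
  qed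
  then obtain g where g: "\<And>x. norm x < \<delta> \<Longrightarrow> norm (g x) \<le> \<rho>"
      "\<And>x. norm x < \<delta> \<Longrightarrow> G x (g x) = g x"
      "\<And>x y. norm x < \<delta> \<Longrightarrow> norm y \<le> \<rho> \<Longrightarrow> G x y = y \<Longrightarrow> y = g x"
    by (metis (no_types, lifting) mem_cball_0)
  \<comment> \<open>The iterates started at 0 are holomorphic in \<open>x\<close> and converge geometrically, at a rate
  independent of \<open>x\<close>, so that their limit is holomorphic as well.\<close>
  define h where "h = (\<lambda>n x. (G x ^^ n) 0)"
  have h_Suc: "h (Suc n) x = G x (h n x)" for n x
    by (simp add: h_def)
  have h_bound: "norm (h n x) \<le> \<rho>" if "norm x < \<delta>" for n x
    using that \<rho> by (induction n) (simp_all add: h_def less_imp_le[OF self_map])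
  have h_close: "norm (h n x - g x) \<le> \<rho> * (1 / 2) ^ n" if x: "norm x < \<delta>" for n x
  proof (induction n)
    case 0
    thus ?case using g(1)[OF x] by (simp add: h_def)
  next
    case (Suc n)
    have "norm (h (Suc n) x - g x) \<le> 1 / 2 * norm (h n x - g x)"
      using contr[OF x h_bound[OF x] g(1)[OF x], of n] g(2)[OF x] by (simp add: h_Suc)
    with Suc show ?case by simp
  qed
  have h_hol: "h n holomorphic_on ball 0 \<delta>" for n
  proof (induction n)
    case (Suc n)
    have "(\<lambda>x. h n x - f x (h n x) / c) holomorphic_on ball 0 \<delta>"
      using c by (intro holomorphic_intros hol Suc) auto
    thus ?case
      by (simp add: h_Suc[abs_def] G_def)
  qed (simp add: h_def)
  have "g holomorphic_on ball 0 \<delta>"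
  proof (rule holomorphic_uniform_sequence[OF open_ball h_hol])
    fix x :: complex assume "x \<in> ball 0 \<delta>"
    then obtain d where d: "d > 0" "cball x d \<subseteq> ball 0 \<delta>"
      using open_contains_cball open_ball by blast
    have "uniform_limit (cball x d) h g sequentially"
    proof (rule uniform_limitI)
      fix \<epsilon> :: real assume "\<epsilon> > 0"
      have "(\<lambda>n. \<rho> * (1 / 2) ^ n) \<longlonglongrightarrow> \<rho> * 0"
        by (intro tendsto_intros LIMSEQ_power_zero) auto
      hence "eventually (\<lambda>n. \<rho> * (1 / 2) ^ n < \<epsilon>) sequentially"
        using \<open>\<epsilon> > 0\<close> by (intro order_tendstoD(2)) auto
      thus "\<forall>\<^sub>F n in sequentially. \<forall>y\<in>cball x d. dist (h n y) (g y) < \<epsilon>"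
      proof eventually_elim
        case (elim n)
        show ?case
          using h_close[of _ n] elim d(2) by (force simp: dist_norm)
      qed
    qed
    thus "\<exists>d>0. cball x d \<subseteq> ball 0 \<delta> \<and> uniform_limit (cball x d) h g sequentially"
      using d by blast
  qed
  moreover have "f x y = 0 \<longleftrightarrow> y = g x" if "norm x < \<delta>" "norm y < \<rho>" for x y
  proof -
    have "f x y = 0 \<longleftrightarrow> G x y = y" using c by (simp add: G_def)
    also have "\<dots> \<longleftrightarrow> y = g x" using g(2,3)[OF that(1)] that(2) by auto
    finally show ?thesis .
  qed
  moreover have "norm (g x) < \<rho>" if "norm x < \<delta>" for x
    using self_map[OF that g(1)[OF that]] g(2)[OF that] by simp
  ultimately show ?thesis
    using that \<delta>(1) \<rho> by blast
qed


section \<open>Zeros of polynomials in two variables\<close>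

lemma poly2_eq_sum: "poly2 q x y = (\<Sum>k\<le>degree q. poly (coeff q k) x * y ^ k)"
  unfolding poly2_def poly_altdef[of q] by (simp add: poly_sum)

definition poly2_dy :: "complex poly poly \<Rightarrow> complex \<Rightarrow> complex \<Rightarrow> complex" where
  "poly2_dy q x y = (\<Sum>k\<le>degree q. poly (coeff q k) x * (of_nat k * y ^ (k - 1)))"

lemma has_field_derivative_poly2:
  "(poly2 q x has_field_derivative poly2_dy q x y) (at y)"
  unfolding poly2_eq_sum[abs_def] poly2_dy_def
  by (auto intro!: derivative_eq_intros sum.cong)

lemma continuous_on_poly2:
  assumes "continuous_on S f" "continuous_on S g"
  shows "continuous_on S (\<lambda>z. poly2 q (f z) (g z))"
  unfolding poly2_eq_sum by (intro continuous_intros assms)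

lemma holomorphic_on_poly2:
  assumes "f holomorphic_on S" "g holomorphic_on S"
  shows "(\<lambda>z. poly2 q (f z) (g z)) holomorphic_on S"
proof -
  have "(\<lambda>z. poly p (f z)) holomorphic_on S" for p
    unfolding poly_altdef by (intro holomorphic_intros assms)
  thus ?thesis
    unfolding poly2_eq_sum by (intro holomorphic_intros assms)
qed

lemma isCont_poly2_dy: "isCont (\<lambda>(x, y). poly2_dy q x y) z"
proof -
  have "continuous_on UNIV (\<lambda>(x, y). poly2_dy q x y)"
    unfolding poly2_dy_def case_prod_unfold by (intro continuous_intros)
  thus ?thesis by (cases z) (simp add: continuous_on_eq_continuous_at)
qed

lemma poly2_slice_nonzero_if_finite_real_zeros:
  assumes "finite {(x, y). poly2 q (complex_of_real x) (complex_of_real y) = 0}"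
    and "infinite A"
  shows "\<exists>x\<in>A. poly2 q (complex_of_real x) (complex_of_real y) \<noteq> 0"
proof (rule ccontr)
  assume "\<not> ?thesis"
  hence "(\<lambda>x. (x, y)) ` A \<subseteq> {(x, y). poly2 q (complex_of_real x) (complex_of_real y) = 0}"
    by auto
  with assms(1) have "finite ((\<lambda>x. (x, y)) ` A)"
    by (rule finite_subset[rotated])
  with assms(2) show False
    by (auto simp: finite_image_iff inj_on_def)
qed

text \<open>
  The slice at a real \<open>y\<close> is a locally uniform limit of the zero-free slices at \<open>y + \<i> / (n + 1)\<close>. It is
  not identically zero, since otherwise \<open>q\<close> would vanish on a whole real line.
\<close>

lemma poly2_nonzero_half_plane_real:
  assumes stable: "\<And>x y. Im x > 0 \<Longrightarrow> Im y > 0 \<Longrightarrow> poly2 q x y \<noteq> 0"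
    and fin: "finite {(x, y). poly2 q (complex_of_real x) (complex_of_real y) = 0}"
    and "Im x > 0"
  shows "poly2 q x (complex_of_real y) \<noteq> 0"
proof
  assume zero: "poly2 q x (complex_of_real y) = 0"
  define H where "H = {x. Im x > 0}"
  define Y where "Y = (\<lambda>n::nat. complex_of_real y + \<i> * complex_of_real (inverse (Suc n)))"
  have Y_lim: "Y \<longlonglongrightarrow> y"
  proof -
    have "Y \<longlonglongrightarrow> complex_of_real y + \<i> * complex_of_real 0"
      unfolding Y_def by (intro tendsto_intros LIMSEQ_inverse_real_of_nat)
    thus ?thesis by simp
  qed
  \<comment> \<open>By Hurwitz, a zero on the boundary slice that is not forced by the slice vanishing identically
  would persist on the slices inside the half plane.\<close>
  have "(\<lambda>x. poly2 q x y) constant_on H"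
  proof (rule ccontr)
    assume "\<not> (\<lambda>x. poly2 q x y) constant_on H"
    hence "poly2 q x y \<noteq> 0"
    proof (rule Hurwitz_no_zeros[of H "\<lambda>n x. poly2 q x (Y n)", rotated 5])
      show "uniform_limit C (\<lambda>n x. poly2 q x (Y n)) (\<lambda>x. poly2 q x y) sequentially"
        if C: "compact C" "C \<subseteq> H" for C
      proof -
        have "uniform_limit C (\<lambda>n x. (x, Y n)) (\<lambda>x. (x, complex_of_real y)) sequentially"
          using Y_lim by (auto simp: uniform_limit_iff tendsto_iff dist_Pair_Pair)
        moreover have "uniformly_continuous_on (C \<times> cball (complex_of_real y) 1) (\<lambda>(x, y). poly2 q x y)"
          unfolding case_prod_unfold
          by (intro compact_uniformly_continuous continuous_on_poly2 continuous_intros compact_Times C compact_cball)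
        moreover have "\<forall>\<^sub>F n in sequentially. \<forall>x\<in>C. (x, Y n) \<in> C \<times> cball (complex_of_real y) 1"
          using tendstoD[OF Y_lim, of 1] by (auto elim!: eventually_mono simp: dist_commute)
        moreover have "closed (C \<times> cball (complex_of_real y) 1)"
          using C by (intro closed_Times compact_imp_closed) auto
        ultimately have "uniform_limit C (\<lambda>n x. case (x, Y n) of (x, y) \<Rightarrow> poly2 q x y)
            (\<lambda>x. case (x, complex_of_real y) of (x, y) \<Rightarrow> poly2 q x y) sequentially"
          by (rule uniform_limit_compose_uniformly_continuous_on)
        thus ?thesis by simp
      qed
      show "poly2 q x (Y n) \<noteq> 0" if "x \<in> H" for n x
        using that by (intro stable) (auto simp: H_def Y_def)
    qed (use \<open>Im x > 0\<close> in \<open>auto simp: H_def intro!: holomorphic_on_poly2 holomorphic_intros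
            open_halfspace_Im_gt convex_connected convex_halfspace_Im_gt\<close>)
    with zero show False by simp
  qed
  hence zero_H: "poly2 q z y = 0" if "z \<in> H" for z
    using that zero \<open>Im x > 0\<close> unfolding constant_on_def H_def by auto
  have "infinite H"
    using \<open>Im x > 0\<close> open_halfspace_Im_gt[of 0] unfolding H_def
    by (metis (mono_tags, lifting) empty_iff finite_imp_not_open mem_Collect_eq)
  hence "poly q [:complex_of_real y:] = 0"
    using zero_H poly_roots_finite[of "poly q [:complex_of_real y:]"] unfolding poly2_def
    by (metis (mono_tags, lifting) finite_subset mem_Collect_eq subsetI)
  thus False
    using poly2_slice_nonzero_if_finite_real_zeros[OF fin infinite_UNIV_char_0, of y]
    by (simp add: poly2_def)
qed

text \<open>
  Only one zero of \<open>q\<close> in \<open>y\<close> is near 0 when \<open>x\<close> is small, so the infimum in the contact order is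
  attained on the branch \<open>g\<close>.
\<close>

lemma bigo_Im_branch_if_contact_order:
  assumes contact: "has_contact_order q K" and "\<delta> > 0" "\<rho> > 0"
    and hol: "g holomorphic_on ball 0 \<delta>" and "g 0 = 0"
    and branch: "\<And>x y. norm x < \<delta> \<Longrightarrow> norm y < \<rho> \<Longrightarrow> poly2 q x y = 0 \<longleftrightarrow> y = g x"
  shows "(\<lambda>x::real. Im (g x)) \<in> O[at 0](\<lambda>x. \<bar>x\<bar> ^ K)"
proof -
  have "eventually (\<lambda>r. r \<in> {0<..<\<rho>}) (at_right (0::real))"
    using \<open>\<rho> > 0\<close> by (intro eventually_at_rightI[of 0 \<rho>]) auto
  moreover have "\<forall>\<^sub>F r in at_right (0::real).
      (\<lambda>x::real. Inf {\<bar>Im y\<bar> |y. norm y < r \<and> poly2 q x y = 0}) \<in> \<Theta>[at 0](\<lambda>x. \<bar>x\<bar> ^ K)"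
    using contact unfolding has_contact_order_def by blast
  ultimately have "\<exists>r. r \<in> {0<..<\<rho>} \<and>
      (\<lambda>x::real. Inf {\<bar>Im y\<bar> |y. norm y < r \<and> poly2 q x y = 0}) \<in> \<Theta>[at 0](\<lambda>x. \<bar>x\<bar> ^ K)"
    by (intro eventually_happens'[OF trivial_limit_at_right_real] eventually_conj)
  then obtain r where r: "0 < r" "r < \<rho>" and Theta:
      "(\<lambda>x::real. Inf {\<bar>Im y\<bar> |y. norm y < r \<and> poly2 q x y = 0}) \<in> \<Theta>[at 0](\<lambda>x. \<bar>x\<bar> ^ K)"
    by auto
  \<comment> \<open>The branch tends to 0, so near \<open>x = 0\<close> it is the one zero counted in the disc of radius \<open>r\<close>.\<close>
  have "isCont g 0"
    using holomorphic_on_imp_continuous_on[OF hol] \<open>\<delta> > 0\<close>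
    by (simp add: continuous_on_eq_continuous_at)
  hence "((\<lambda>x::real. g x) \<longlongrightarrow> g (of_real 0)) (at 0)"
    by (intro isCont_tendsto_compose[of _ g] tendsto_intros) simp
  hence "eventually (\<lambda>x::real. norm (g x) < r) (at 0)"
    using \<open>g 0 = 0\<close> \<open>r > 0\<close> by (auto simp: tendsto_iff)
  moreover have "eventually (\<lambda>x::real. norm x < \<delta>) (at 0)"
    using \<open>\<delta> > 0\<close> by (auto simp: eventually_at intro!: exI[of _ \<delta>])
  ultimately have "eventually (\<lambda>x::real.
      Inf {\<bar>Im y\<bar> |y. norm y < r \<and> poly2 q x y = 0} = \<bar>Im (g x)\<bar>) (at 0)"
  proof eventually_elim
    case (elim x)
    have "{\<bar>Im y\<bar> |y. norm y < r \<and> poly2 q x y = 0} = {\<bar>Im (g x)\<bar>}"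
      using elim r branch[of x] by force
    thus ?case by simp
  qed
  with Theta have "(\<lambda>x::real. \<bar>Im (g x)\<bar>) \<in> \<Theta>[at 0](\<lambda>x. \<bar>x\<bar> ^ K)"
    by (subst (asm) landau_theta.in_cong)
  thus ?thesis by (auto simp: bigtheta_def)
qed


section \<open>The arithmetic mean of the disc in half plane coordinates\<close>

text \<open>
  The Cayley transform \<open>\<beta> x = (1 + \<i> * x) / (1 - \<i> * x)\<close> maps the upper half plane to the unit disc;
  \<open>disc_mean\<close> is the arithmetic mean of the disc pulled back along it, that is
  \<open>\<beta> (disc_mean x y) = (\<beta> x + \<beta> y) / 2\<close>.
\<close>

definition disc_mean :: "complex \<Rightarrow> complex \<Rightarrow> complex" where
  "disc_mean x y = (\<i> * (x + y) + 2 * x * y) / (2 * \<i> + x + y)"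

lemma disc_mean_denominator_nonzero:
  assumes "Im x \<ge> 0" "Im y \<ge> 0"
  shows "2 * \<i> + x + y \<noteq> 0"
  using assms by (auto simp: complex_eq_iff)

lemma disc_mean_same:
  assumes "x \<noteq> - \<i>"
  shows "disc_mean x x = x"
proof -
  have "disc_mean x x = x * (2 * (x + \<i>)) / (2 * (x + \<i>))"
    by (simp add: disc_mean_def algebra_simps)
  also have "\<dots> = x"
    using assms by (intro nonzero_mult_div_cancel_right)
      (simp add: eq_neg_iff_add_eq_0 del: distrib_left_numeral)
  finally show ?thesis .
qed

text \<open>
  Real points correspond to the unit circle. The disc is strictly convex, so the mean of two distinct
  boundary points is an interior point.
\<close>

lemma Im_disc_mean_real:
  fixes x y :: real
  shows "Im (disc_mean x y) = (x - y)\<^sup>2 / (4 + (x + y)\<^sup>2)"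
proof -
  have "4 + (x + y)\<^sup>2 > 0"
    by (smt (verit) zero_le_power2)
  thus ?thesis
    unfolding disc_mean_def
    by (simp add: Im_divide power2_eq_square divide_simps) (simp add: algebra_simps)
qed

text \<open>
  The inversion \<open>v \<mapsto> - 1 / v\<close> exchanges the disc \<open>Im v > (norm v)\<^sup>2\<close> and the half plane above height 1.
  It is a form of the Cayley transform adapted to shifted points \<open>x + \<i>\<close>.
\<close>

lemma Im_neg_inverse_gt_norm2_iff:
  assumes "v \<noteq> 0"
  shows "Im v > (norm v)\<^sup>2 \<longleftrightarrow> Im (- 1 / v) > 1"
proof -
  have "Im (- 1 / v) = Im v / (norm v)\<^sup>2"
    by (simp add: Im_divide cmod_power2 add.commute)
  moreover have "(norm v)\<^sup>2 > 0" using assms by simp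
  ultimately show ?thesis
    by (simp add: pos_less_divide_eq)
qed

text \<open>
  \<open>disc_mean x y + \<i>\<close> is the harmonic mean of \<open>x + \<i>\<close> and \<open>y + \<i>\<close>. In the coordinate \<open>- 1 / (x + \<i>)\<close> it
  becomes the arithmetic mean, and the upper half plane becomes a disc, which is convex.
\<close>

lemma disc_mean_in_upper_half_plane:
  assumes "Im x > 0" "Im y > 0"
  shows "Im (disc_mean x y) > 0"
proof -
  define u v w where "u = - 1 / (x + \<i>)" and "v = - 1 / (y + \<i>)" and "w = (u + v) / 2"
  have nz: "x + \<i> \<noteq> 0" "y + \<i> \<noteq> 0" "2 * \<i> + x + y \<noteq> 0"
    using assms by (auto simp: complex_eq_iff)
  have uv: "u \<noteq> 0" "v \<noteq> 0" using nz by (auto simp: u_def v_def)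
  have "Im u > (norm u)\<^sup>2" "Im v > (norm v)\<^sup>2"
    unfolding Im_neg_inverse_gt_norm2_iff[OF uv(1)] Im_neg_inverse_gt_norm2_iff[OF uv(2)]
    using assms nz by (auto simp: u_def v_def)
  moreover have "(norm (u + v))\<^sup>2 \<le> 2 * ((norm u)\<^sup>2 + (norm v)\<^sup>2)"
    using zero_le_power2[of "Re u - Re v"] zero_le_power2[of "Im u - Im v"]
    unfolding cmod_power2 by (simp add: power2_eq_square algebra_simps)
  hence "(norm w)\<^sup>2 \<le> ((norm u)\<^sup>2 + (norm v)\<^sup>2) / 2"
    by (simp add: w_def norm_divide power_divide)
  ultimately have w: "Im w > (norm w)\<^sup>2"
    by (simp add: w_def)
  hence "w \<noteq> 0" by auto
  have "disc_mean x y + \<i> = - 1 / w"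
  proof -
    have "w = - (2 * \<i> + x + y) / (2 * (x + \<i>) * (y + \<i>))"
    proof -
      have "(- 1 / X + - 1 / Y) / 2 = - (X + Y) / (2 * X * Y)" if "X \<noteq> 0" "Y \<noteq> 0" for X Y :: complex
        using that by (simp add: field_simps)
      moreover have "x + \<i> + (y + \<i>) = 2 * \<i> + x + y" by simp
      ultimately show ?thesis
        using nz(1,2) unfolding w_def u_def v_def by metis
    qed
    moreover have "- 1 / (- N / D) = D / N" for N D :: complex
      by simp
    ultimately have "- 1 / w = 2 * (x + \<i>) * (y + \<i>) / (2 * \<i> + x + y)"
      by metis
    also have "\<dots> = disc_mean x y + \<i>"
      unfolding disc_mean_def using nz by (simp add: divide_simps) (simp add: algebra_simps)
    finally show ?thesis ..
  qed
  moreover have "Im (- 1 / w) > 1"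
    using w Im_neg_inverse_gt_norm2_iff[OF \<open>w \<noteq> 0\<close>] by blast
  ultimately have "Im (disc_mean x y + \<i>) > 1"
    by metis
  thus ?thesis by simp
qed

lemma disc_mean_small:
  assumes "norm x < R" "norm y < R" "R \<le> 1 / 2"
  shows "2 * \<i> + x + y \<noteq> 0" "norm (disc_mean x y) < 3 * R"
proof -
  have "norm (2 * \<i>) \<le> norm (2 * \<i> + x + y) + norm (x + y)"
    using norm_triangle_ineq4[of "2 * \<i> + x + y" "x + y"] by simp
  hence den: "norm (2 * \<i> + x + y) > 1"
    using norm_triangle_ineq[of x y] assms by (simp add: norm_mult)
  thus "2 * \<i> + x + y \<noteq> 0" by auto
  have "R > 0"
    using assms(1) norm_ge_zero[of x] by linarith
  have "norm x * norm y \<le> R * (1 / 2)"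
    using assms \<open>R > 0\<close> by (intro mult_mono) auto
  hence "norm (\<i> * (x + y) + 2 * x * y) < 3 * R"
    using norm_triangle_ineq[of "\<i> * (x + y)" "2 * x * y"] norm_triangle_ineq[of x y] assms(1,2)
    by (simp add: norm_mult)
  also have "3 * R \<le> 3 * R * norm (2 * \<i> + x + y)"
    using den \<open>R > 0\<close> by simp
  finally show "norm (disc_mean x y) < 3 * R"
    unfolding disc_mean_def norm_divide using den by (subst pos_divide_less_eq) auto
qed

lemma has_field_derivative_disc_mean:
  assumes "2 * \<i> + x + y \<noteq> 0"
  shows "(disc_mean x has_field_derivative 2 * (x + \<i>)\<^sup>2 / (2 * \<i> + x + y)\<^sup>2) (at y)"
  unfolding disc_mean_def[abs_def] using assms
  by (auto intro!: derivative_eq_intros simp: power2_eq_square divide_simps) (simp add: algebra_simps)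

lemma holomorphic_on_disc_mean:
  assumes "\<And>x. x \<in> S \<Longrightarrow> 2 * \<i> + x + y \<noteq> 0"
  shows "(\<lambda>x. disc_mean x y) holomorphic_on S"
  unfolding disc_mean_def by (intro holomorphic_intros assms)

lemma continuous_on_disc_mean:
  assumes "\<And>z. z \<in> S \<Longrightarrow> 2 * \<i> + fst z + snd z \<noteq> 0"
  shows "continuous_on S (\<lambda>z. disc_mean (fst z) (snd z))"
  unfolding disc_mean_def by (intro continuous_intros) (use assms in auto)


section \<open>Composition with the mean\<close>

lemma ex_power_series2_comp_disc_mean:
  assumes "\<delta> > 0" and hol: "f holomorphic_on ball 0 \<delta>"
  shows "\<exists>a. has_power_series2_at_0 (\<lambda>x y. f (disc_mean x y)) a"
proof -
  \<comment> \<open>Small enough for the mean of two points of the bidisc to lie in the disc on which \<open>f\<close> lives.\<close>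
  define R where "R = min (1 / 2) (\<delta> / 3)"
  have R: "R > 0" "R \<le> 1 / 2" "3 * R \<le> \<delta>"
    using \<open>\<delta> > 0\<close> by (auto simp: R_def)
  have nz: "2 * \<i> + x + y \<noteq> 0" and small: "disc_mean x y \<in> ball 0 \<delta>"
    if "x \<in> ball 0 R" "y \<in> ball 0 R" for x y
    using disc_mean_small[of x R y] that R by auto
  have hol_deriv: "deriv f holomorphic_on ball 0 \<delta>"
    using hol by (intro holomorphic_deriv) auto
  have cont_mean: "continuous_on (ball 0 R \<times> ball 0 R) (\<lambda>z. disc_mean (fst z) (snd z))"
    by (intro continuous_on_disc_mean nz) auto
  have cont_comp: "continuous_on (ball 0 R \<times> ball 0 R) (\<lambda>z. h (disc_mean (fst z) (snd z)))"
    if "h holomorphic_on ball 0 \<delta>" for h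
    by (rule continuous_on_compose2[OF holomorphic_on_imp_continuous_on[OF that] cont_mean])
       (use small in auto)
  show ?thesis
  proof (rule has_power_series2_at_0_if_holomorphic[OF \<open>R > 0\<close>])
    fix y :: complex assume y: "y \<in> ball 0 R"
    show "(\<lambda>x. f (disc_mean x y)) holomorphic_on ball 0 R"
      by (rule holomorphic_on_compose_gen[OF holomorphic_on_disc_mean hol, unfolded o_def])
         (use nz small y in auto)
  next
    fix x y :: complex assume xy: "x \<in> ball 0 R" "y \<in> ball 0 R"
    show "((\<lambda>y. f (disc_mean x y)) has_field_derivative
        deriv f (disc_mean x y) * (2 * (x + \<i>)\<^sup>2 / (2 * \<i> + x + y)\<^sup>2)) (at y)"
      by (rule DERIV_chain2[OF holomorphic_derivI[OF hol open_ball small[OF xy]]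
            has_field_derivative_disc_mean[OF nz[OF xy]]])
  next
    show "continuous_on (ball 0 R \<times> ball 0 R) (\<lambda>(x, y). f (disc_mean x y))"
      using cont_comp[OF hol] by (simp add: case_prod_unfold)
    show "continuous_on (ball 0 R \<times> ball 0 R)
        (\<lambda>(x, y). deriv f (disc_mean x y) * (2 * (x + \<i>)\<^sup>2 / (2 * \<i> + x + y)\<^sup>2))"
      unfolding case_prod_unfold
      by (intro continuous_intros cont_comp[OF hol_deriv]) (use nz in auto)
  qed
qed

text \<open>
  On the diagonal the mean is the identity.
\<close>

lemma disc_mean_comp_diagonal_sums:
  assumes "has_power_series2_at_0 (\<lambda>x y. f (disc_mean x y)) a"
  shows "\<exists>r>0. \<forall>t. norm t < r \<longrightarrow> (\<lambda>d. homogeneous_part a d 1 1 * t ^ d) sums f t"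
proof -
  obtain r where r: "r > 0" "\<And>t. norm t < r \<Longrightarrow>
      (\<lambda>d. homogeneous_part a d 1 1 * t ^ d) sums f (disc_mean (t * 1) (t * 1))"
    using homogeneous_part_sums[OF assms, of 1 1] by blast
  show ?thesis
  proof (intro exI[of _ "min r 1"] conjI allI impI)
    fix t :: complex assume t: "norm t < min r 1"
    hence "t \<noteq> - \<i>" by auto
    thus "(\<lambda>d. homogeneous_part a d 1 1 * t ^ d) sums f t"
      using r(2)[of t] t disc_mean_same[of t] by simp
  qed (use r in auto)
qed

text \<open>
  On the line \<open>y = 0\<close> the mean is \<open>\<i> * t / (2 * \<i> + t) = t / 2 + \<i> / 4 * t\<^sup>2 + \<dots>\<close>; its quadratic term is
  purely imaginary, and this is what turns a real linear coefficient of \<open>f\<close> into an imaginary part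
  in degree 2. The coefficients of \<open>f\<close> appear as homogeneous parts on the diagonal.
\<close>

lemma disc_mean_comp_quadratic_coeff:
  assumes series: "has_power_series2_at_0 (\<lambda>x y. f (disc_mean x y)) a" and "f 0 = 0"
  shows "homogeneous_part a 2 1 0 = \<i> / 4 * homogeneous_part a 1 1 1 + homogeneous_part a 2 1 1 / 4"
proof -
  define b where "b = (\<lambda>d. homogeneous_part a d 1 1)"
  define c where "c = (\<lambda>d. homogeneous_part a d 1 0)"
  define w where "w = (\<lambda>t. disc_mean t 0)"
  have "\<exists>r>0. \<forall>t. norm t < r \<longrightarrow> (\<lambda>d. b d * t ^ d) sums f t"
    using disc_mean_comp_diagonal_sums[OF series] by (simp add: b_def)
  then obtain r where r: "r > 0" "\<And>t. norm t < r \<Longrightarrow> (\<lambda>d. b d * t ^ d) sums f t"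
    by blast
  have "\<exists>s>0. \<forall>t. norm t < s \<longrightarrow> (\<lambda>d. c d * t ^ d) sums f (w t)"
    using homogeneous_part_sums[OF series, of 1 0] by (simp add: c_def w_def)
  then obtain s where s: "s > 0" "\<And>t. norm t < s \<Longrightarrow> (\<lambda>d. c d * t ^ d) sums f (w t)"
    by blast
  have "b 0 = 0"
    using powser_coeff_0[OF r] \<open>f 0 = 0\<close> by simp
  have "c 0 = 0"
    using powser_coeff_0[OF s] \<open>f 0 = 0\<close> by (simp add: w_def disc_mean_def)
  \<comment> \<open>The coefficients up to degree 2 of \<open>f\<close> and of \<open>f \<circ> w\<close> as limits of Taylor remainders.\<close>
  have f_lim1: "((\<lambda>u. f u / u) \<longlongrightarrow> b 1) (at 0)"
    using powser_remainder_tendsto[OF r, of 1] \<open>b 0 = 0\<close> by simp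
  have f_lim2: "((\<lambda>u. (f u - b 1 * u) / u\<^sup>2) \<longlongrightarrow> b 2) (at 0)"
    using powser_remainder_tendsto[OF r, of 2] \<open>b 0 = 0\<close> by (simp add: numeral_2_eq_2)
  have fw_lim1: "((\<lambda>t. f (w t) / t) \<longlongrightarrow> c 1) (at 0)"
    using powser_remainder_tendsto[OF s, of 1] \<open>c 0 = 0\<close> by simp
  have fw_lim2: "((\<lambda>t. (f (w t) - c 1 * t) / t\<^sup>2) \<longlongrightarrow> c 2) (at 0)"
    using powser_remainder_tendsto[OF s, of 2] \<open>c 0 = 0\<close> by (simp add: numeral_2_eq_2)

  \<comment> \<open>The expansion \<open>w t = t / 2 + \<i> / 4 * t\<^sup>2 + \<dots>\<close>.\<close>
  have "eventually (\<lambda>t::complex. t \<in> ball 0 2 - {0}) (at 0)"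
    by (intro eventually_at_in_open) auto
  hence near: "eventually (\<lambda>t::complex. t \<noteq> 0 \<and> 2 * \<i> + t \<noteq> 0) (at 0)"
    by (rule eventually_mono) (auto simp: add_eq_0_iff)
  have w_eq: "w t = \<i> * t / (2 * \<i> + t)" for t
    by (simp add: w_def disc_mean_def)
  have w_div: "((\<lambda>t. w t / t) \<longlongrightarrow> 1 / 2) (at 0)"
  proof (rule Lim_transform_eventually)
    show "((\<lambda>t. \<i> / (2 * \<i> + t)) \<longlongrightarrow> 1 / 2) (at 0)"
      by (auto intro!: tendsto_eq_intros)
    show "eventually (\<lambda>t. \<i> / (2 * \<i> + t) = w t / t) (at 0)"
      using near by eventually_elim (auto simp: w_eq)
  qed
  have w_div2: "((\<lambda>t. (w t - t / 2) / t\<^sup>2) \<longlongrightarrow> \<i> / 4) (at 0)"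
  proof (rule Lim_transform_eventually)
    show "((\<lambda>t. - 1 / (2 * (2 * \<i> + t))) \<longlongrightarrow> \<i> / 4) (at 0)"
      by (auto intro!: tendsto_eq_intros simp: field_simps)
    show "eventually (\<lambda>t. - 1 / (2 * (2 * \<i> + t)) = (w t - t / 2) / t\<^sup>2) (at 0)"
      using near
    proof eventually_elim
      case (elim t)
      define D where "D = 2 * \<i> + t"
      have "t = D - 2 * \<i>" "D \<noteq> 0" using elim by (auto simp: D_def)
      have "\<i> * t / D - t / 2 = - (t\<^sup>2 / (2 * D))"
        using \<open>D \<noteq> 0\<close> by (simp add: field_simps \<open>t = D - 2 * \<i>\<close> power2_eq_square)
      hence "(w t - t / 2) / t\<^sup>2 = - (t\<^sup>2 / (2 * D)) / t\<^sup>2"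
        by (simp only: w_eq D_def)
      also have "\<dots> = - 1 / (2 * D)"
        using elim by simp
      finally show ?case
        by (simp only: D_def)
    qed
  qed
  have w_nz: "eventually (\<lambda>t. w t \<noteq> 0) (at 0)"
    using near by eventually_elim (auto simp: w_eq)
  have "((\<lambda>t. \<i> * t / (2 * \<i> + t)) \<longlongrightarrow> 0) (at 0)"
    by (auto intro!: tendsto_eq_intros)
  hence w_lim: "filterlim w (at 0) (at 0)"
    unfolding filterlim_at using w_nz by (simp add: w_eq[abs_def])

  have "((\<lambda>t. f (w t) / w t * (w t / t)) \<longlongrightarrow> b 1 * (1 / 2)) (at 0)"
    by (intro tendsto_mult w_div filterlim_compose[OF f_lim1 w_lim])
  hence "((\<lambda>t. f (w t) / t) \<longlongrightarrow> b 1 * (1 / 2)) (at 0)"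
    by (rule Lim_transform_eventually) (use w_nz in \<open>eventually_elim, auto\<close>)
  hence c1: "c 1 = b 1 / 2"
    using fw_lim1 LIM_unique by fastforce
  have "((\<lambda>t. (f (w t) - b 1 * w t) / (w t)\<^sup>2 * (w t / t)\<^sup>2 + b 1 * ((w t - t / 2) / t\<^sup>2))
          \<longlongrightarrow> b 2 * (1 / 2)\<^sup>2 + b 1 * (\<i> / 4)) (at 0)"
    by (intro tendsto_intros w_div w_div2 filterlim_compose[OF f_lim2 w_lim])
  hence "((\<lambda>t. (f (w t) - c 1 * t) / t\<^sup>2) \<longlongrightarrow> b 2 * (1 / 2)\<^sup>2 + b 1 * (\<i> / 4)) (at 0)"
  proof (rule Lim_transform_eventually)
    show "eventually (\<lambda>t. (f (w t) - b 1 * w t) / (w t)\<^sup>2 * (w t / t)\<^sup>2 + b 1 * ((w t - t / 2) / t\<^sup>2)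
            = (f (w t) - c 1 * t) / t\<^sup>2) (at 0)"
      using near w_nz unfolding c1 by eventually_elim (simp add: field_simps)
  qed
  with fw_lim2 have "c 2 = b 2 * (1 / 2)\<^sup>2 + b 1 * (\<i> / 4)"
    using LIM_unique by blast
  thus ?thesis
    by (simp add: b_def c_def power2_eq_square)
qed


section \<open>Zeros of the substituted polynomial\<close>

theorem proposition1p7:
  fixes q :: "complex poly poly" and p :: "complex poly poly poly" and m n K :: nat
  assumes "\<forall>x y. Im x > 0 \<and> Im y > 0 \<longrightarrow> poly2 q x y \<noteq> 0"
    and "bidegree q = (m, n)"
    and "finite {(x, y). poly2 q (complex_of_real x) (complex_of_real y) = 0}"
    and "poly2 q 0 0 = 0"
    and "deriv (\<lambda>y. poly2 q 0 y) 0 \<noteq> 0"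
    and "has_contact_order q K"
    and "K > 2"
    and "\<forall>x y z. 2 * \<i> + x + y \<noteq> 0 \<longrightarrow>
           poly3 p x y z = (2 * \<i> + x + y) ^ m *
             poly2 q ((\<i> * (x + y) + 2 * x * y) / (2 * \<i> + x + y)) z"
  shows "(\<forall>x y z. Im x > 0 \<and> Im y > 0 \<and> Im z > 0 \<longrightarrow> poly3 p x y z \<noteq> 0)
    \<and> finite {(x, y, z).
        poly3 p (complex_of_real x) (complex_of_real y) (complex_of_real z) = 0}
    \<and> (\<exists>\<phi> a. has_power_series2_at_0 \<phi> a \<and> \<phi> 0 0 = 0
        \<and> (\<exists>\<epsilon>>0. \<forall>x y z. norm x < \<epsilon> \<and> norm y < \<epsilon> \<and> norm z < \<epsilon> \<longrightarrow>
              (poly3 p x y z = 0 \<longleftrightarrow> z + \<phi> x y = 0))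
        \<and> (\<exists>x y. homogeneous_part (Im_series a) 2 x y \<noteq> 0)
        \<and> (\<forall>k\<in>{1..<K}. \<forall>x. homogeneous_part (Im_series a) k x x = 0))"
proof -
  have stable: "poly2 q x y \<noteq> 0" if "Im x > 0" "Im y > 0" for x y
    using assms(1) that by blast
  have p_zero_iff: "poly3 p x y z = 0 \<longleftrightarrow> poly2 q (disc_mean x y) z = 0"
    if "2 * \<i> + x + y \<noteq> 0" for x y z
    using assms(8) that by (simp add: disc_mean_def)

  have "poly3 p x y z \<noteq> 0" if "Im x > 0" "Im y > 0" "Im z > 0" for x y z
    using p_zero_iff[OF disc_mean_denominator_nonzero] stable disc_mean_in_upper_half_plane that
    by simp
  moreover have "finite {(x, y, z).
      poly3 p (complex_of_real x) (complex_of_real y) (complex_of_real z) = 0}"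
  proof (rule finite_subset)
    show "{(x, y, z). poly3 p (complex_of_real x) (complex_of_real y) (complex_of_real z) = 0}
        \<subseteq> (\<lambda>(x, z). (x, x, z)) ` {(x, y). poly2 q (complex_of_real x) (complex_of_real y) = 0}"
    proof clarify
      fix x y z :: real
      assume "poly3 p (complex_of_real x) (complex_of_real y) (complex_of_real z) = 0"
      hence zero: "poly2 q (disc_mean x y) z = 0"
        using p_zero_iff[OF disc_mean_denominator_nonzero] by simp
      \<comment> \<open>A real zero with \<open>x \<noteq> y\<close> would give a zero of \<open>q\<close> with first coordinate in the open half plane.\<close>
      hence "\<not> Im (disc_mean x y) > 0"
        using poly2_nonzero_half_plane_real[OF stable assms(3)] by blast
      moreover have "4 + (x + y)\<^sup>2 > 0"
        by (smt (verit) zero_le_power2)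
      ultimately have "x = y"
        by (auto simp: Im_disc_mean_real zero_less_divide_iff)
      moreover have "disc_mean x x = x"
        by (rule disc_mean_same) (auto simp: complex_eq_iff)
      ultimately show "(x, y, z) \<in> (\<lambda>(x, z). (x, x, z)) `
          {(x, y). poly2 q (complex_of_real x) (complex_of_real y) = 0}"
        using zero by (auto simp: image_iff)
    qed
  qed (use assms(3) in simp)
  moreover have "\<exists>\<phi> a. has_power_series2_at_0 \<phi> a \<and> \<phi> 0 0 = 0
        \<and> (\<exists>\<epsilon>>0. \<forall>x y z. norm x < \<epsilon> \<and> norm y < \<epsilon> \<and> norm z < \<epsilon> \<longrightarrow>
              (poly3 p x y z = 0 \<longleftrightarrow> z + \<phi> x y = 0))
        \<and> (\<exists>x y. homogeneous_part (Im_series a) 2 x y \<noteq> 0)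
        \<and> (\<forall>k\<in>{1..<K}. \<forall>x. homogeneous_part (Im_series a) k x x = 0)"
  proof -
    have dy: "poly2_dy q 0 0 \<noteq> 0"
      using assms(5) DERIV_imp_deriv[OF has_field_derivative_poly2[of q 0 0]] by simp
    obtain g \<delta> \<rho> where \<delta>: "\<delta> > 0" and \<rho>: "\<rho> > 0" and hol_g: "g holomorphic_on ball 0 \<delta>"
      and g_less: "\<And>x. norm x < \<delta> \<Longrightarrow> norm (g x) < \<rho>"
      and branch: "\<And>x y. norm x < \<delta> \<Longrightarrow> norm y < \<rho> \<Longrightarrow> poly2 q x y = 0 \<longleftrightarrow> y = g x"
      by (rule holomorphic_implicit_function[of "poly2 q" "poly2_dy q",
            OF holomorphic_on_poly2[OF holomorphic_on_ident] has_field_derivative_poly2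
               isCont_poly2_dy assms(4) dy]) blast+
    define \<psi> where "\<psi> = (\<lambda>x. - g x)"
    have "\<psi> 0 = 0"
      using branch[of 0 0] \<delta> \<rho> assms(4) by (simp add: \<psi>_def)
    have "\<psi> holomorphic_on ball 0 \<delta>"
      unfolding \<psi>_def by (intro holomorphic_intros hol_g)
    then obtain a where a: "has_power_series2_at_0 (\<lambda>x y. \<psi> (disc_mean x y)) a"
      using ex_power_series2_comp_disc_mean[OF \<delta>] by blast
    define b where "b = (\<lambda>d. homogeneous_part a d 1 1)"
    obtain r where r: "r > 0" "\<And>t. norm t < r \<Longrightarrow> (\<lambda>d. b d * t ^ d) sums \<psi> t"
      using disc_mean_comp_diagonal_sums[OF a] unfolding b_def by blast

    \<comment> \<open>The diagonal restriction of \<open>\<psi> (disc_mean x y)\<close> is \<open>\<psi>\<close> itself, so the \<open>b k\<close> are also the Taylor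
    coefficients of \<open>\<psi>\<close>.\<close>
    have Im_b: "Im (b k) = 0" if "k < K" for k
    proof (rule powser_coeff_eq_0_if_bigo[OF r(1) _ _ that])
      show "(\<lambda>n. Im (b n) * x ^ n) sums Im (\<psi> (complex_of_real x))" if "norm x < r" for x
      proof -
        have "Im (b n * complex_of_real x ^ n) = Im (b n) * x ^ n" for n
          by (simp flip: of_real_power)
        thus ?thesis
          using sums_Im[OF r(2)[of "complex_of_real x"]] that by simp
      qed
      show "(\<lambda>x. Im (\<psi> (complex_of_real x))) \<in> O[at 0](\<lambda>x. \<bar>x\<bar> ^ K)"
        using bigo_Im_branch_if_contact_order[OF assms(6) \<delta> \<rho> hol_g _ branch] \<open>\<psi> 0 = 0\<close>
        by (simp add: \<psi>_def)
    qed

    \<comment> \<open>Near the origin the zeros of \<open>q\<close> are \<open>y = - \<psi> x\<close>, so by stability \<open>\<psi>\<close> maps points of the upper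
    half plane into the closed upper half plane.\<close>
    have "b 1 \<noteq> 0"
    proof -
      define s where "s = min r \<delta>"
      have s: "s > 0" "s \<le> r" "s \<le> \<delta>" using r \<delta> by (auto simp: s_def)
      obtain x0 where x0: "x0 \<in> {0<..<s}" "poly2 q (complex_of_real x0) (complex_of_real 0) \<noteq> 0"
        using poly2_slice_nonzero_if_finite_real_zeros[OF assms(3), of "{0<..<s}" 0] s by auto
      show ?thesis
      proof (rule linear_coeff_nonzero_if_upper_half_plane[OF s(1)])
        show "(\<lambda>n. b n * x ^ n) sums \<psi> x" if "norm x < s" for x
          using r(2) s that by simp
        show "Im (\<psi> x) \<ge> 0" if "norm x < s" "Im x > 0" for x
        proof (rule ccontr)
          assume "\<not> ?thesis"
          hence "poly2 q x (g x) \<noteq> 0" using that by (intro stable) (auto simp: \<psi>_def)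
          thus False using branch[of x "g x"] g_less[of x] that s by simp
        qed
        show "b 0 = 0"
          using powser_coeff_0[OF r] \<open>\<psi> 0 = 0\<close> by simp
        show "norm (complex_of_real x0) < s" "\<psi> (complex_of_real x0) \<noteq> 0"
          using x0 s branch[of x0 0] \<rho> by (auto simp: \<psi>_def)
      qed
    qed

    show ?thesis
    proof (intro exI conjI ballI allI)
      show "has_power_series2_at_0 (\<lambda>x y. \<psi> (disc_mean x y)) a" by (rule a)
      show "\<psi> (disc_mean 0 0) = 0" using \<open>\<psi> 0 = 0\<close> by (simp add: disc_mean_def)
      define \<epsilon> where "\<epsilon> = min (min (1 / 2) (\<delta> / 3)) \<rho>"
      show "\<epsilon> > 0" using \<delta> \<rho> by (simp add: \<epsilon>_def)
      show "norm x < \<epsilon> \<and> norm y < \<epsilon> \<and> norm z < \<epsilon> \<longrightarrow>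
          (poly3 p x y z = 0 \<longleftrightarrow> z + \<psi> (disc_mean x y) = 0)" for x y z
      proof safe
        assume xyz: "norm x < \<epsilon>" "norm y < \<epsilon>" "norm z < \<epsilon>"
        have "2 * \<i> + x + y \<noteq> 0" "norm (disc_mean x y) < \<delta>"
          using disc_mean_small[of x "min (1 / 2) (\<delta> / 3)" y] xyz unfolding \<epsilon>_def by linarith+
        hence eq: "poly3 p x y z = 0 \<longleftrightarrow> z + \<psi> (disc_mean x y) = 0"
          using p_zero_iff branch xyz by (simp add: \<psi>_def \<epsilon>_def)
        show "z + \<psi> (disc_mean x y) = 0" if "poly3 p x y z = 0"
          using that eq by blast
        show "poly3 p x y z = 0" if "z + \<psi> (disc_mean x y) = 0"
          using that eq by blast
      qed
      \<comment> \<open>In degree 2 the coefficients \<open>b 1\<close> and \<open>b 2\<close> are real because \<open>K > 2\<close>.\<close>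
      have "homogeneous_part a 2 1 0 = \<i> / 4 * b 1 + b 2 / 4"
        using disc_mean_comp_quadratic_coeff[OF a \<open>\<psi> 0 = 0\<close>] by (simp add: b_def)
      hence "Im (homogeneous_part a 2 1 0) = Re (b 1) / 4"
        using Im_b[of 2] \<open>K > 2\<close> by simp
      moreover have "Re (b 1) \<noteq> 0"
        using \<open>b 1 \<noteq> 0\<close> Im_b[of 1] \<open>K > 2\<close> by (auto simp: complex_eq_iff)
      ultimately show "homogeneous_part (Im_series a) 2 1 0 \<noteq> 0"
        using homogeneous_part_Im_series_real[of a 2 1 0] by simp
      show "homogeneous_part (Im_series a) k x x = 0" if "k \<in> {1..<K}" for k x
        using homogeneous_part_Im_series_real[of a k 1 1] Im_b[of k] that
        by (simp add: homogeneous_part_same[of _ k x] b_def)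
    qed
  qed
  ultimately show ?thesis by blast
qed

end
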